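(* Let $G$ be a group and let $R$ be a $G$-graded ring. If $R$ is graded left Noetherian, then the graded two-sided ideal $\mathcal{Z}^{\rm gr}({}_RR)$ is nilpotent.
   Context: Rings are associative with identity; a $G$-graded ring is $R=\bigoplus_{g\in G}R_g$ with $R_gR_h\subset R_{gh}$. Graded left Noetherian means ACC on graded left ideals. For $x\in R$, $\mathrm{ann}_\ell(x)=\{r\in R: rx=0\}$. A left ideal is essential in ${}_RR$ if it meets every nonzero left ideal nontrivially (for graded left ideals it is equivalent to test against nonzero graded left ideals only). For $g\in G$ put $\mathcal{Z}^{\rm gr}({}_RR)_g=\{x\in R_g:\mathrm{ann}_\ell(x)\text{ is essential in }{}_RR\}$, and $\mathcal{Z}^{\rm gr}({}_RR)=\sum_{g\in G}\mathcal{Z}^{\rm gr}({}_RR)_g$ (the graded singular radical), which is a graded two-sided ideal of $R$. *)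

theory Defs
  imports "HOL-Algebra.Ideal_Product"
begin

section \<open>Left ideals, annihilators, essentiality, nilpotency\<close>

definition left_ideal :: "('a, 'n) ring_scheme \<Rightarrow> 'a set \<Rightarrow> bool" where
  "left_ideal R I \<longleftrightarrow> additive_subgroup I R \<and>
     (\<forall>r \<in> carrier R. \<forall>x \<in> I. r \<otimes>\<^bsub>R\<^esub> x \<in> I)"

definition left_annihilator :: "('a, 'n) ring_scheme \<Rightarrow> 'a \<Rightarrow> 'a set" where
  "left_annihilator R x = {r \<in> carrier R. r \<otimes>\<^bsub>R\<^esub> x = \<zero>\<^bsub>R\<^esub>}"

definition essential_left_ideal :: "('a, 'n) ring_scheme \<Rightarrow> 'a set \<Rightarrow> bool" where
  "essential_left_ideal R I \<longleftrightarrow> left_ideal R I \<and>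
     (\<forall>J. left_ideal R J \<and> J \<noteq> {\<zero>\<^bsub>R\<^esub>} \<longrightarrow> I \<inter> J \<noteq> {\<zero>\<^bsub>R\<^esub>})"

text \<open>Powers are taken in the multiplicative structure of ideals: the product of two ideals is
  the additive span of the pairwise products, and the zeroth power is the whole ring.\<close>

definition nilpotent_ideal :: "('a, 'n) ring_scheme \<Rightarrow> 'a set \<Rightarrow> bool" where
  "nilpotent_ideal R I \<longleftrightarrow> (\<exists>n::nat. n \<ge> 1 \<and> I [^]\<^bsub>ideals_set R\<^esub> n = {\<zero>\<^bsub>R\<^esub>})"


section \<open>Group-graded rings\<close>

text \<open>The (not necessarily direct) sum of a family of subsets of a ring indexed by
  the elements of \<open>G\<close>. As \<open>G\<close> may be infinite and \<^const>\<open>finsum\<close> is only meaningful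
  over finite index sets, the sums range over arbitrary finite sets \<open>S\<close> of degrees.\<close>

definition family_sum ::
    "('g, 'm) monoid_scheme \<Rightarrow> ('a, 'n) ring_scheme \<Rightarrow> ('g \<Rightarrow> 'a set) \<Rightarrow> 'a set" where
  "family_sum G R B =
     {finsum R f S | f S. finite S \<and> S \<subseteq> carrier G \<and> (\<forall>g \<in> S. f g \<in> B g)}"

locale graded_ring = G: group G + R: ring R
  for G :: "('g, 'm) monoid_scheme" and R :: "('a, 'n) ring_scheme" +
  fixes A :: "'g \<Rightarrow> 'a set"
  assumes component_subgroup: "g \<in> carrier G \<Longrightarrow> additive_subgroup (A g) R"
    and sum_components: "family_sum G R A = carrier R"
    and independent: "\<lbrakk>finite S; S \<subseteq> carrier G; \<forall>g \<in> S. f g \<in> A g; finsum R f S = \<zero>\<^bsub>R\<^esub>\<rbrakk>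
        \<Longrightarrow> \<forall>g \<in> S. f g = \<zero>\<^bsub>R\<^esub>"
    and mult_components: "\<lbrakk>g \<in> carrier G; h \<in> carrier G; x \<in> A g; y \<in> A h\<rbrakk>
        \<Longrightarrow> x \<otimes>\<^bsub>R\<^esub> y \<in> A (g \<otimes>\<^bsub>G\<^esub> h)"

definition graded_subset ::
    "('g, 'm) monoid_scheme \<Rightarrow> ('a, 'n) ring_scheme \<Rightarrow> ('g \<Rightarrow> 'a set) \<Rightarrow> 'a set \<Rightarrow> bool" where
  "graded_subset G R A I \<longleftrightarrow> I = family_sum G R (\<lambda>g. I \<inter> A g)"

definition graded_left_ideal ::
    "('g, 'm) monoid_scheme \<Rightarrow> ('a, 'n) ring_scheme \<Rightarrow> ('g \<Rightarrow> 'a set) \<Rightarrow> 'a set \<Rightarrow> bool" where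
  "graded_left_ideal G R A I \<longleftrightarrow> left_ideal R I \<and> graded_subset G R A I"

definition graded_left_noetherian ::
    "('g, 'm) monoid_scheme \<Rightarrow> ('a, 'n) ring_scheme \<Rightarrow> ('g \<Rightarrow> 'a set) \<Rightarrow> bool" where
  "graded_left_noetherian G R A \<longleftrightarrow>
     (\<forall>I :: nat \<Rightarrow> 'a set.
        (\<forall>n. graded_left_ideal G R A (I n)) \<and> (\<forall>n. I n \<subseteq> I (Suc n)) \<longrightarrow>
        (\<exists>N. \<forall>n \<ge> N. I n = I N))"


section \<open>The graded singular radical\<close>

definition singular_component ::
    "('a, 'n) ring_scheme \<Rightarrow> ('g \<Rightarrow> 'a set) \<Rightarrow> 'g \<Rightarrow> 'a set" where
  "singular_component R A g = {x \<in> A g. essential_left_ideal R (left_annihilator R x)}"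

definition graded_singular_radical ::
    "('g, 'm) monoid_scheme \<Rightarrow> ('a, 'n) ring_scheme \<Rightarrow> ('g \<Rightarrow> 'a set) \<Rightarrow> 'a set" where
  "graded_singular_radical G R A = family_sum G R (singular_component R A)"


section \<open>The graded singular radical is a graded two-sided ideal\<close>

lemma (in ring) additive_subgroupI':
  assumes "H \<subseteq> carrier R" "\<zero> \<in> H" "\<And>x y. \<lbrakk>x \<in> H; y \<in> H\<rbrakk> \<Longrightarrow> x \<oplus> y \<in> H"
    "\<And>x. x \<in> H \<Longrightarrow> \<ominus> x \<in> H"
  shows "additive_subgroup H R"
  by (rule additive_subgroup.intro, rule subgroup.intro)
     (use assms in \<open>auto simp: a_inv_def[symmetric]\<close>)

lemma (in ring) additive_subgroup_minus:
  assumes "additive_subgroup H R" "x \<in> H"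
  shows "\<ominus> x \<in> H"
  using subgroup.m_inv_closed[OF additive_subgroup.a_subgroup[OF assms(1)] assms(2)]
  by (simp add: a_inv_def)

lemma (in ring) left_annihilator_left_ideal:
  assumes "x \<in> carrier R"
  shows "left_ideal R (left_annihilator R x)"
  unfolding left_ideal_def
proof (intro conjI ballI)
  show "additive_subgroup (left_annihilator R x) R"
    by (rule additive_subgroupI') (use assms in \<open>auto simp: left_annihilator_def l_distr l_minus\<close>)
qed (use assms in \<open>auto simp: left_annihilator_def m_assoc\<close>)

lemma (in ring) essential_left_ideal_mono:
  assumes "essential_left_ideal R I" "left_ideal R J" "I \<subseteq> J"
  shows "essential_left_ideal R J"
  unfolding essential_left_ideal_def
proof (intro conjI allI impI notI)
  fix K assume K: "left_ideal R K \<and> K \<noteq> {\<zero>}" and "J \<inter> K = {\<zero>}"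
  moreover have "\<zero> \<in> I" "\<zero> \<in> K"
    using assms K additive_subgroup.zero_closed
    unfolding essential_left_ideal_def left_ideal_def by blast+
  ultimately have "I \<inter> K = {\<zero>}" using assms(3) by blast
  with K assms(1) show False by (auto simp: essential_left_ideal_def)
qed (fact assms(2))

lemma (in ring) left_ideal_Int:
  assumes "left_ideal R I" "left_ideal R J"
  shows "left_ideal R (I \<inter> J)"
proof -
  have "additive_subgroup (I \<inter> J) R"
    using assms additive_subgroup_minus
    by (intro additive_subgroupI')
       (auto simp: left_ideal_def additive_subgroup.zero_closed additive_subgroup.a_closed
         dest: additive_subgroup.a_Hcarr)
  with assms show ?thesis by (auto simp: left_ideal_def)
qed

lemma (in ring) essential_left_ideal_Int:
  assumes "essential_left_ideal R I" "essential_left_ideal R J"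
  shows "essential_left_ideal R (I \<inter> J)"
  using assms left_ideal_Int unfolding essential_left_ideal_def by (metis Int_assoc)

lemma (in ring) left_ideal_image:
  assumes "left_ideal R L" "r \<in> carrier R"
  shows "left_ideal R ((\<lambda>s. s \<otimes> r) ` L)"
proof -
  interpret L: additive_subgroup L R using assms by (simp add: left_ideal_def)
  have "additive_subgroup ((\<lambda>s. s \<otimes> r) ` L) R"
  proof (rule additive_subgroupI')
    show "(\<lambda>s. s \<otimes> r) ` L \<subseteq> carrier R" using assms(2) L.a_Hcarr by auto
    show "\<zero> \<in> (\<lambda>s. s \<otimes> r) ` L"
      using assms(2) L.zero_closed by (metis image_eqI l_null)
    fix x assume "x \<in> (\<lambda>s. s \<otimes> r) ` L"
    then obtain s where s: "s \<in> L" "x = s \<otimes> r" by auto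
    have "\<ominus> x = (\<ominus> s) \<otimes> r" using s assms(2) L.a_Hcarr by (simp add: l_minus)
    with additive_subgroup_minus[OF L.additive_subgroup_axioms s(1)]
    show "\<ominus> x \<in> (\<lambda>s. s \<otimes> r) ` L" by blast
    fix y assume "y \<in> (\<lambda>s. s \<otimes> r) ` L"
    then obtain t where t: "t \<in> L" "y = t \<otimes> r" by auto
    have "x \<oplus> y = (s \<oplus> t) \<otimes> r" using s t assms(2) L.a_Hcarr by (simp add: l_distr)
    with L.a_closed[OF s(1) t(1)] show "x \<oplus> y \<in> (\<lambda>s. s \<otimes> r) ` L" by blast
  qed
  moreover have "a \<otimes> (s \<otimes> r) \<in> (\<lambda>s. s \<otimes> r) ` L" if "a \<in> carrier R" "s \<in> L" for a s
  proof -
    have "a \<otimes> (s \<otimes> r) = (a \<otimes> s) \<otimes> r" using that assms(2) L.a_Hcarr by (simp add: m_assoc)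
    with that assms(1) show ?thesis by (auto simp: left_ideal_def)
  qed
  ultimately show ?thesis by (auto simp: left_ideal_def)
qed

lemma (in ring) essential_left_annihilator_zero:
  "essential_left_ideal R (left_annihilator R \<zero>)"
proof -
  have "left_annihilator R \<zero> = carrier R" by (auto simp: left_annihilator_def)
  moreover have "carrier R \<inter> J = J" if "left_ideal R J" for J
    using that by (auto simp: left_ideal_def dest: additive_subgroup.a_Hcarr)
  ultimately show ?thesis
    using left_annihilator_left_ideal[of \<zero>] by (simp add: essential_left_ideal_def)
qed

lemma (in ring) essential_left_annihilator_add:
  assumes "x \<in> carrier R" "y \<in> carrier R"
    "essential_left_ideal R (left_annihilator R x)" "essential_left_ideal R (left_annihilator R y)"
  shows "essential_left_ideal R (left_annihilator R (x \<oplus> y))"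
proof (rule essential_left_ideal_mono[OF essential_left_ideal_Int[OF assms(3,4)]])
  show "left_ideal R (left_annihilator R (x \<oplus> y))"
    using assms by (simp add: left_annihilator_left_ideal)
qed (use assms in \<open>auto simp: left_annihilator_def r_distr\<close>)

lemma (in ring) essential_left_annihilator_mult_right:
  assumes "x \<in> carrier R" "r \<in> carrier R" "essential_left_ideal R (left_annihilator R x)"
  shows "essential_left_ideal R (left_annihilator R (x \<otimes> r))"
proof (rule essential_left_ideal_mono[OF assms(3)])
  show "left_ideal R (left_annihilator R (x \<otimes> r))"
    using assms by (simp add: left_annihilator_left_ideal)
qed (use assms in \<open>auto simp: left_annihilator_def simp flip: m_assoc\<close>)

lemma (in ring) essential_left_annihilator_mult_left:
  assumes x: "x \<in> carrier R" and r: "r \<in> carrier R"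
    and ess: "essential_left_ideal R (left_annihilator R x)"
  shows "essential_left_ideal R (left_annihilator R (r \<otimes> x))"
  unfolding essential_left_ideal_def
proof (intro conjI allI impI notI)
  show "left_ideal R (left_annihilator R (r \<otimes> x))"
    using x r by (simp add: left_annihilator_left_ideal)
next
  fix L assume L: "left_ideal R L \<and> L \<noteq> {\<zero>}" and triv: "left_annihilator R (r \<otimes> x) \<inter> L = {\<zero>}"
  interpret L: additive_subgroup L R using L by (simp add: left_ideal_def)
  let ?K = "(\<lambda>s. s \<otimes> r) ` L"
  have K: "left_ideal R ?K" using L r left_ideal_image by blast
  have zK: "\<zero> \<in> ?K" using K by (simp add: left_ideal_def additive_subgroup.zero_closed)
  have key: "s = \<zero>" if s: "s \<in> L" and "s \<otimes> r \<in> left_annihilator R x" for s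
  proof -
    have "s \<in> left_annihilator R (r \<otimes> x)"
      using that x r L.a_Hcarr[OF s] by (simp add: left_annihilator_def m_assoc)
    with s triv show ?thesis by blast
  qed
  have "\<zero> \<in> left_annihilator R x" using x by (simp add: left_annihilator_def)
  moreover have "\<zero> \<otimes> r = \<zero>" using r by simp
  ultimately have "left_annihilator R x \<inter> ?K = {\<zero>}"
    using key zK by blast
  then have K0: "?K = {\<zero>}" using ess K unfolding essential_left_ideal_def by blast
  have "s = \<zero>" if "s \<in> L" for s
  proof -
    have "s \<otimes> r = \<zero>" using K0 that by blast
    then show ?thesis using key[OF that] \<open>\<zero> \<in> left_annihilator R x\<close> by simp
  qed
  with L L.zero_closed show False by blast
qed

context graded_ring
begin

lemma component_closed: "\<lbrakk>g \<in> carrier G; x \<in> A g\<rbrakk> \<Longrightarrow> x \<in> carrier R"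
  using component_subgroup additive_subgroup.a_Hcarr by metis

lemma family_sum_subset:
  assumes "additive_subgroup H R" "\<And>g. g \<in> carrier G \<Longrightarrow> B g \<subseteq> H"
  shows "family_sum G R B \<subseteq> H"
proof
  fix x assume "x \<in> family_sum G R B"
  then obtain f S where S: "finite S" "S \<subseteq> carrier G" "\<forall>g \<in> S. f g \<in> B g" "x = finsum R f S"
    unfolding family_sum_def by blast
  interpret H: additive_subgroup H R by fact
  have "finsum R f S \<in> H"
    using S(1-3)
  proof (induction S rule: finite_induct)
    case empty
    then show ?case by (simp add: H.zero_closed)
  next
    case (insert g S)
    then have "f g \<in> H" "f \<in> S \<rightarrow> carrier R" using assms(2) H.a_Hcarr by blast+
    with insert show ?case using H.a_Hcarr by simp
  qed
  with S show "x \<in> H" by simp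
qed

lemma component_subset_family_sum:
  assumes "g \<in> carrier G" "B g \<subseteq> carrier R"
  shows "B g \<subseteq> family_sum G R B"
proof
  fix x assume x: "x \<in> B g"
  have "finsum R (\<lambda>_. x) {g} = x" using x assms by auto
  then show "x \<in> family_sum G R B"
    using x assms unfolding family_sum_def by (auto intro!: exI[of _ "\<lambda>_. x"] exI[of _ "{g}"])
qed

lemma family_sum_additive_subgroup:
  assumes B: "\<And>g. g \<in> carrier G \<Longrightarrow> additive_subgroup (B g) R"
  shows "additive_subgroup (family_sum G R B) R"
proof (rule R.additive_subgroupI')
  have Bc: "b \<in> carrier R" if "g \<in> carrier G" "b \<in> B g" for g b
    using that B additive_subgroup.a_Hcarr by metis
  show "family_sum G R B \<subseteq> carrier R"
    unfolding family_sum_def using Bc by (auto intro!: R.finsum_closed)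
  show "\<zero>\<^bsub>R\<^esub> \<in> family_sum G R B"
    unfolding family_sum_def by (auto intro!: exI[of _ "{}"])
  fix x assume "x \<in> family_sum G R B"
  then obtain f S where S: "finite S" "S \<subseteq> carrier G" "\<forall>g \<in> S. f g \<in> B g" "x = finsum R f S"
    unfolding family_sum_def by blast
  have fS: "f \<in> S \<rightarrow> carrier R" using S Bc by blast
  have "x \<oplus>\<^bsub>R\<^esub> finsum R (\<lambda>g. \<ominus>\<^bsub>R\<^esub> f g) S = finsum R (\<lambda>g. f g \<oplus>\<^bsub>R\<^esub> (\<ominus>\<^bsub>R\<^esub> f g)) S"
    using S(4) fS by (subst R.finsum_addf) auto
  also have "\<dots> = finsum R (\<lambda>g. \<zero>\<^bsub>R\<^esub>) S"
    using R.r_neg[OF Pi_mem[OF fS]] by (intro R.finsum_cong') auto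
  finally have "x \<oplus>\<^bsub>R\<^esub> finsum R (\<lambda>g. \<ominus>\<^bsub>R\<^esub> f g) S = \<zero>\<^bsub>R\<^esub>"
    by simp
  moreover have "x \<in> carrier R" "finsum R (\<lambda>g. \<ominus>\<^bsub>R\<^esub> f g) S \<in> carrier R"
    using S(4) R.finsum_closed[OF fS] fS by (auto intro!: R.finsum_closed)
  ultimately have "\<ominus>\<^bsub>R\<^esub> x = finsum R (\<lambda>g. \<ominus>\<^bsub>R\<^esub> f g) S"
    by (metis R.minus_equality R.a_comm)
  moreover have "\<forall>g \<in> S. \<ominus>\<^bsub>R\<^esub> f g \<in> B g"
    using S B R.additive_subgroup_minus by blast
  ultimately show "\<ominus>\<^bsub>R\<^esub> x \<in> family_sum G R B"
    using S unfolding family_sum_def by blast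
  fix y assume "y \<in> family_sum G R B"
  then obtain h T where T: "finite T" "T \<subseteq> carrier G" "\<forall>g \<in> T. h g \<in> B g" "y = finsum R h T"
    unfolding family_sum_def by blast
  have hT: "h \<in> T \<rightarrow> carrier R" using T Bc by blast
  let ?f = "\<lambda>g. if g \<in> S then f g else \<zero>\<^bsub>R\<^esub>" and ?h = "\<lambda>g. if g \<in> T then h g else \<zero>\<^bsub>R\<^esub>"
  have "x = finsum R ?f (S \<union> T)" "y = finsum R ?h (S \<union> T)"
    unfolding S(4) T(4) using S(1) T(1) fS hT
    by (intro R.add.finprod_mono_neutral_cong_left; auto)+
  then have "x \<oplus>\<^bsub>R\<^esub> y = finsum R (\<lambda>g. ?f g \<oplus>\<^bsub>R\<^esub> ?h g) (S \<union> T)"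
    using fS hT by (subst R.finsum_addf) auto
  moreover have "?f g \<oplus>\<^bsub>R\<^esub> ?h g \<in> B g" if "g \<in> S \<union> T" for g
  proof -
    interpret Bg: additive_subgroup "B g" R using B that S T by blast
    show ?thesis using S T that by auto
  qed
  ultimately show "x \<oplus>\<^bsub>R\<^esub> y \<in> family_sum G R B"
    using S(1,2) T(1,2) unfolding family_sum_def by blast
qed

lemma singular_component_additive_subgroup:
  assumes g: "g \<in> carrier G"
  shows "additive_subgroup (singular_component R A g) R"
proof (rule R.additive_subgroupI')
  interpret Ag: additive_subgroup "A g" R using component_subgroup[OF g] .
  show "singular_component R A g \<subseteq> carrier R"
    by (auto simp: singular_component_def)
  show "\<zero>\<^bsub>R\<^esub> \<in> singular_component R A g"
    by (simp add: singular_component_def R.essential_left_annihilator_zero Ag.zero_closed)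
  show "x \<oplus>\<^bsub>R\<^esub> y \<in> singular_component R A g"
    if "x \<in> singular_component R A g" "y \<in> singular_component R A g" for x y
    using that by (auto simp: singular_component_def intro: R.essential_left_annihilator_add)
  show "\<ominus>\<^bsub>R\<^esub> x \<in> singular_component R A g" if x: "x \<in> singular_component R A g" for x
  proof -
    have "x \<in> carrier R" using x by (simp add: singular_component_def)
    then have "left_annihilator R (\<ominus>\<^bsub>R\<^esub> x) = left_annihilator R x"
      by (auto simp: left_annihilator_def R.r_minus)
    with x show ?thesis
      using R.additive_subgroup_minus[OF component_subgroup[OF g]]
      by (simp add: singular_component_def)
  qed
qed

lemma singular_component_mult:
  assumes "g \<in> carrier G" "h \<in> carrier G" "x \<in> singular_component R A g" "r \<in> A h"
  shows "x \<otimes>\<^bsub>R\<^esub> r \<in> singular_component R A (g \<otimes>\<^bsub>G\<^esub> h)"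
    and "r \<otimes>\<^bsub>R\<^esub> x \<in> singular_component R A (h \<otimes>\<^bsub>G\<^esub> g)"
  using assms component_closed[of g x] component_closed[of h r]
  by (auto simp: singular_component_def mult_components
      intro: R.essential_left_annihilator_mult_right R.essential_left_annihilator_mult_left)

lemma singular_component_subset_radical:
  assumes "g \<in> carrier G"
  shows "singular_component R A g \<subseteq> graded_singular_radical G R A"
  unfolding graded_singular_radical_def
  by (rule component_subset_family_sum[OF assms])
     (use assms component_closed in \<open>auto simp: singular_component_def\<close>)

lemma graded_singular_radical_ideal: "ideal (graded_singular_radical G R A) R"
proof -
  let ?Z = "graded_singular_radical G R A"
  have Z: "additive_subgroup ?Z R"
    unfolding graded_singular_radical_def
    by (rule family_sum_additive_subgroup) (rule singular_component_additive_subgroup)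
  interpret Z: additive_subgroup ?Z R by (rule Z)
  note Zm = R.additive_subgroup_minus[OF Z]
  have step: "x \<otimes>\<^bsub>R\<^esub> r \<in> ?Z \<and> r \<otimes>\<^bsub>R\<^esub> x \<in> ?Z"
    if g: "g \<in> carrier G" and x: "x \<in> singular_component R A g" and r: "r \<in> carrier R" for g x r
  proof -
    have xR: "x \<in> carrier R" using component_closed[OF g] x by (simp add: singular_component_def)
    let ?H = "{r \<in> carrier R. x \<otimes>\<^bsub>R\<^esub> r \<in> ?Z \<and> r \<otimes>\<^bsub>R\<^esub> x \<in> ?Z}"
    have "additive_subgroup ?H R"
      by (rule R.additive_subgroupI')
         (use xR Zm in \<open>auto simp: R.r_distr R.l_distr R.r_minus R.l_minus Z.zero_closed\<close>)
    moreover have "A h \<subseteq> ?H" if "h \<in> carrier G" for h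
      using singular_component_mult[OF g that x] singular_component_subset_radical
        component_closed[OF that] g that by blast
    ultimately have "family_sum G R A \<subseteq> ?H" by (rule family_sum_subset)
    with r show ?thesis unfolding sum_components by blast
  qed
  let ?H = "{x \<in> carrier R. \<forall>r \<in> carrier R. x \<otimes>\<^bsub>R\<^esub> r \<in> ?Z \<and> r \<otimes>\<^bsub>R\<^esub> x \<in> ?Z}"
  have "additive_subgroup ?H R"
    by (rule R.additive_subgroupI')
       (use Zm in \<open>auto simp: R.r_distr R.l_distr R.r_minus R.l_minus Z.zero_closed\<close>)
  moreover have "singular_component R A g \<subseteq> ?H" if "g \<in> carrier G" for g
    using step[OF that] component_closed[OF that] by (auto simp: singular_component_def)
  ultimately have "?Z \<subseteq> ?H"
    unfolding graded_singular_radical_def by (rule family_sum_subset)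
  then show ?thesis
    by (intro idealI R.ring_axioms Z.a_subgroup) auto
qed

lemma graded_singular_radical_graded: "graded_subset G R A (graded_singular_radical G R A)"
  unfolding graded_subset_def
proof
  let ?Z = "graded_singular_radical G R A"
  have "singular_component R A g \<subseteq> ?Z \<inter> A g" if "g \<in> carrier G" for g
    using singular_component_subset_radical[OF that] by (auto simp: singular_component_def)
  then show "?Z \<subseteq> family_sum G R (\<lambda>g. ?Z \<inter> A g)"
    unfolding graded_singular_radical_def[of G R A] family_sum_def by blast
  show "family_sum G R (\<lambda>g. ?Z \<inter> A g) \<subseteq> ?Z"
    using ideal.axioms(1)[OF graded_singular_radical_ideal] by (rule family_sum_subset) blast
qed

end

end

theory Submission
  imports Defs
begin

text \<open>Let \<open>H\<close> be the set of homogeneous elements with essential left annihilator, and \<open>H\<^sup>n\<close>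
  the set of products of \<open>n\<close> elements of \<open>H\<close>. The left annihilators of the \<open>H\<^sup>n\<close> form an
  ascending chain of graded left ideals, which stabilises at some \<open>n\<close>. If \<open>H\<^bsup>n+1\<^esup> \<noteq> {0}\<close>,
  choose \<open>a \<in> H\<close> with \<open>a H\<^sup>n \<noteq> {0}\<close> and with maximal left annihilator. For \<open>b \<in> H\<close> the left
  annihilator of \<open>b\<close> meets \<open>R a\<close> nontrivially, so the left annihilator of \<open>a b\<close> is strictly
  larger than that of \<open>a\<close> and \<open>a b H\<^sup>n = {0}\<close> by maximality. Hence \<open>a\<close> annihilates \<open>H\<^bsup>n+1\<^esup>\<close>,
  and therefore \<open>H\<^sup>n\<close>, a contradiction.\<close>

section \<open>Set products, annihilators, powers of ideals and the maximal condition\<close>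

text \<open>The index is shifted by one: \<open>set_products R X n\<close> consists of products of \<open>n + 1\<close> factors.\<close>

primrec set_products :: "('a, 'n) ring_scheme \<Rightarrow> 'a set \<Rightarrow> nat \<Rightarrow> 'a set" where
  "set_products R X 0 = X"
| "set_products R X (Suc n) = set_products R X n <#>\<^bsub>R\<^esub> X"

definition left_annihilator_set :: "('a, 'n) ring_scheme \<Rightarrow> 'a set \<Rightarrow> 'a set" where
  "left_annihilator_set R X = {r \<in> carrier R. \<forall>x \<in> X. r \<otimes>\<^bsub>R\<^esub> x = \<zero>\<^bsub>R\<^esub>}"

lemma left_annihilator_set_singleton: "left_annihilator_set R {x} = left_annihilator R x"
  by (simp add: left_annihilator_set_def left_annihilator_def)

lemma left_annihilator_set_antimono:
  "X \<subseteq> Y \<Longrightarrow> left_annihilator_set R Y \<subseteq> left_annihilator_set R X"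
  by (auto simp: left_annihilator_set_def)

lemma set_products_Suc_subset:
  assumes "X <#>\<^bsub>R\<^esub> X \<subseteq> X"
  shows "set_products R X (Suc n) \<subseteq> set_products R X n"
proof (induction n)
  case (Suc n)
  then show ?case
    unfolding set_products.simps(2)[of R X "Suc n"] set_products.simps(2)[of R X n]
    by (auto simp: set_mult_def)
qed (use assms in simp)

context ring
begin

lemma set_products_closed:
  assumes "X \<subseteq> carrier R"
  shows "set_products R X n \<subseteq> carrier R"
  by (induction n) (use assms in \<open>auto simp: set_mult_closed\<close>)

text \<open>The recursion adds factors on the right, while the main argument splits off the leftmost
  factor; associativity reconciles the two.\<close>

lemma set_products_Suc_left:
  assumes "X \<subseteq> carrier R"
  shows "set_products R X (Suc n) = X <#> set_products R X n"
proof (induction n)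
  case (Suc n)
  then have "set_products R X (Suc (Suc n)) = (X <#> set_products R X n) <#> X"
    by simp
  also have "\<dots> = X <#> (set_products R X n <#> X)"
    using assms set_products_closed[OF assms] 
    by (auto 0 4 simp: set_mult_def m_assoc subset_iff)
  finally show ?case by simp
qed simp

lemma left_annihilator_set_left_ideal:
  assumes "X \<subseteq> carrier R"
  shows "left_ideal R (left_annihilator_set R X)"
  unfolding left_ideal_def
proof (intro conjI ballI)
  show "additive_subgroup (left_annihilator_set R X) R"
    by (rule additive_subgroupI')
       (use assms in \<open>auto simp: left_annihilator_set_def l_distr l_minus subset_iff\<close>)
qed (use assms in \<open>auto simp: left_annihilator_set_def m_assoc subset_iff\<close>)

text \<open>The annihilator of \<open>b\<close> is essential and \<open>R a\<close> is nonzero, so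
  they share some \<open>r a \<noteq> 0\<close>; this \<open>r\<close> kills \<open>a b\<close> but
  not \<open>a\<close>.\<close>

lemma left_annihilator_mult_strict:
  assumes a: "a \<in> carrier R" "a \<noteq> \<zero>" and b: "b \<in> carrier R"
    and ess: "essential_left_ideal R (left_annihilator R b)"
  shows "left_annihilator R a \<subset> left_annihilator R (a \<otimes> b)"
proof
  show "left_annihilator R a \<subseteq> left_annihilator R (a \<otimes> b)"
    using a b by (auto simp: left_annihilator_def simp flip: m_assoc)
  let ?Ra = "(\<lambda>r. r \<otimes> a) ` carrier R"
  have "left_ideal R ?Ra"
    by (rule left_ideal_image)
       (use a oneideal in \<open>auto simp: left_ideal_def ideal.axioms(1)\<close>)
  moreover have "\<one> \<otimes> a \<in> ?Ra" by blast
  with a have "?Ra \<noteq> {\<zero>}" by auto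
  ultimately have "left_annihilator R b \<inter> ?Ra \<noteq> {\<zero>}"
    using ess by (simp add: essential_left_ideal_def)
  moreover have "\<zero> \<otimes> a \<in> ?Ra" by blast
  with a b have "\<zero> \<in> left_annihilator R b \<inter> ?Ra"
    by (simp add: left_annihilator_def)
  ultimately obtain r where r: "r \<in> carrier R" "r \<otimes> a \<in> left_annihilator R b"
    "r \<otimes> a \<noteq> \<zero>"
    by blast
  then have "r \<in> left_annihilator R (a \<otimes> b)" "r \<notin> left_annihilator R a"
    using a b by (auto simp: left_annihilator_def m_assoc)
  then show "left_annihilator R a \<noteq> left_annihilator R (a \<otimes> b)" by blast
qed

lemma ideals_set_pow_ideal:
  assumes "ideal I R"
  shows "ideal (I [^]\<^bsub>ideals_set R\<^esub> (n::nat)) R"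
  by (induction n) (use assms in \<open>simp_all add: ideals_set_def oneideal ideal_prod_is_ideal\<close>)

text \<open>Reduces powers of \<open>I\<close> to products of elements of \<open>X\<close>:
  \<open>gen\<close> says that \<open>I\<close> lies in the additive span of \<open>X\<close>. The
  subgroup \<open>K\<close> is arbitrary so that the induction can replace it by a transporter
  subgroup.\<close>

lemma ideals_set_pow_subset:
  assumes I: "ideal I R" and X: "X \<subseteq> carrier R"
    and gen: "\<And>K. \<lbrakk>additive_subgroup K R; X \<subseteq> K\<rbrakk> \<Longrightarrow> I \<subseteq> K"
    and K: "additive_subgroup K R" "set_products R X n \<subseteq> K"
  shows "I [^]\<^bsub>ideals_set R\<^esub> Suc n \<subseteq> K"
  using K
proof (induction n arbitrary: K)
  case 0
  \<comment> \<open>The zeroth power is the whole ring, so the first power unfolds to this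
    product.\<close>
  have "carrier R \<cdot> I \<subseteq> I"
    using ideal_prod_inter[OF oneideal I] by simp
  moreover have "I \<subseteq> K" using 0 by (intro gen) simp_all
  ultimately show ?case by (simp add: ideals_set_def)
next
  case (Suc n)
  interpret K: additive_subgroup K R by (rule Suc.prems)
  let ?P = "I [^]\<^bsub>ideals_set R\<^esub> Suc n"
  have prod: "y \<otimes> x \<in> K" if "y \<in> ?P" "x \<in> I" for x y
  proof -
    \<comment> \<open>The induction hypothesis is applied with \<open>?L\<close> in place of
      \<open>K\<close>; it handles the left factor against \<open>X\<close> only.\<close>
    let ?L = "{y \<in> carrier R. \<forall>x \<in> X. y \<otimes> x \<in> K}"
    have "additive_subgroup ?L R"
      by (rule additive_subgroupI')
         (use X additive_subgroup_minus[OF Suc.prems(1)] in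
           \<open>auto simp: l_distr l_minus subset_iff\<close>)
    moreover have "set_products R X n \<subseteq> ?L"
      using Suc.prems(2) set_products_closed[OF X] by (fastforce simp: set_mult_def)
    ultimately have "?P \<subseteq> ?L" by (rule Suc.IH)
    then have y: "y \<in> ?L" using that by blast
    \<comment> \<open>With \<open>y\<close> fixed, \<open>gen\<close> extends the right factor from
      \<open>X\<close> to \<open>I\<close>.\<close>
    let ?M = "{x \<in> carrier R. y \<otimes> x \<in> K}"
    have "additive_subgroup ?M R"
      by (rule additive_subgroupI')
         (use y additive_subgroup_minus[OF Suc.prems(1)] in
           \<open>auto simp: r_distr r_minus\<close>)
    moreover have "X \<subseteq> ?M" using X y by blast
    ultimately have "I \<subseteq> ?M" by (rule gen)
    with that show ?thesis by blast
  qed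
  have "?P \<cdot> I \<subseteq> K"
  proof
    fix s assume "s \<in> ?P \<cdot> I"
    then show "s \<in> K"
      by (induction s rule: ideal_prod.induct) (blast intro: prod)+
  qed
  moreover have "I [^]\<^bsub>ideals_set R\<^esub> Suc (Suc n) = ?P \<cdot> I"
    by (simp add: ideals_set_def)
  ultimately show ?case by simp
qed

end

text \<open>Without a maximal member, dependent choice builds a strictly ascending chain in
  \<open>F\<close>.\<close>

lemma graded_left_noetherian_maximal:
  assumes noeth: "graded_left_noetherian G R A"
    and F: "\<And>I. I \<in> F \<Longrightarrow> graded_left_ideal G R A I" "F \<noteq> {}"
  shows "\<exists>I \<in> F. \<forall>J \<in> F. I \<subseteq> J \<longrightarrow> J = I"
proof (rule ccontr)
  assume "\<not> ?thesis"
  then have "\<forall>I \<in> F. \<exists>J. J \<in> F \<and> I \<subset> J" by blast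
  moreover have "\<exists>I. I \<in> F" using F(2) by blast
  ultimately obtain f :: "nat \<Rightarrow> _" where f: "\<And>n. f n \<in> F" "\<And>n. f n \<subset> f (Suc n)"
    using dependent_nat_choice[of "\<lambda>_ I. I \<in> F" "\<lambda>_ I J. I \<subset> J"] by metis
  have "(\<forall>n. graded_left_ideal G R A (f n)) \<and> (\<forall>n. f n \<subseteq> f (Suc n))"
    using f F(1) by blast
  then have "\<exists>N. \<forall>n \<ge> N. f n = f N"
    by (rule noeth[unfolded graded_left_noetherian_def, rule_format])
  then obtain N where "\<forall>n \<ge> N. f n = f N" ..
  then have "f (Suc N) = f N" using le_SucI[OF order_refl] by blast
  with f(2)[of N] show False by simp
qed

section \<open>Annihilators of homogeneous sets are graded\<close>

context graded_ring
begin

text \<open>Right translation by \<open>h\<close> is injective, so the terms \<open>f g x\<close>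
  lie in distinct degrees and cannot cancel.\<close>

lemma mult_homogeneous_eq_zero:
  assumes S: "finite S" "S \<subseteq> carrier G" "\<forall>g \<in> S. f g \<in> A g"
    and h: "h \<in> carrier G" "x \<in> A h" and zero: "finsum R f S \<otimes>\<^bsub>R\<^esub> x = \<zero>\<^bsub>R\<^esub>"
  shows "\<forall>g \<in> S. f g \<otimes>\<^bsub>R\<^esub> x = \<zero>\<^bsub>R\<^esub>"
proof -
  have x: "x \<in> carrier R" using h component_closed by blast
  have f: "f \<in> S \<rightarrow> carrier R" using S component_closed by blast
  let ?s = "\<lambda>g. g \<otimes>\<^bsub>G\<^esub> h"
  \<comment> \<open>The family is indexed by the new degree \<open>k = g h\<close>, as
    \<open>independent\<close> requires; \<open>k h^-1\<close> recovers \<open>g\<close>.\<close>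
  let ?f = "\<lambda>k. f (k \<otimes>\<^bsub>G\<^esub> inv\<^bsub>G\<^esub> h) \<otimes>\<^bsub>R\<^esub> x"
  have fs: "?f (?s g) = f g \<otimes>\<^bsub>R\<^esub> x" if "g \<in> S" for g
    using that S h by (simp add: G.m_assoc subset_iff)
  have fx: "f g \<otimes>\<^bsub>R\<^esub> x \<in> carrier R" if "g \<in> S" for g
    using that f x by blast
  have "finsum R ?f (?s ` S) = finsum R (\<lambda>g. ?f (?s g)) S"
  proof (rule R.finsum_reindex)
    show "?f \<in> ?s ` S \<rightarrow> carrier R" using fs fx by auto
    show "inj_on ?s S" using S(2) h(1) by (auto simp: inj_on_def subset_iff)
  qed
  also have "\<dots> = finsum R (\<lambda>g. f g \<otimes>\<^bsub>R\<^esub> x) S"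
    using fs fx by (intro R.finsum_cong') auto
  also have "\<dots> = \<zero>\<^bsub>R\<^esub>"
    using R.finsum_ldistr[OF S(1) x f] zero by simp
  finally have "finsum R ?f (?s ` S) = \<zero>\<^bsub>R\<^esub>" .
  moreover have "\<forall>k \<in> ?s ` S. ?f k \<in> A k"
    using fs S h mult_components by (auto simp: subset_iff)
  moreover have "?s ` S \<subseteq> carrier G" using S h by auto
  ultimately have "\<forall>k \<in> ?s ` S. ?f k = \<zero>\<^bsub>R\<^esub>" using S(1) by (intro independent) auto
  with fs show ?thesis by simp
qed

text \<open>Since \<open>X\<close> is homogeneous, every component of an element killing
  \<open>X\<close> kills \<open>X\<close> as well.\<close>

lemma left_annihilator_set_graded_left_ideal:
  assumes X: "X \<subseteq> (\<Union>h \<in> carrier G. A h)"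
  shows "graded_left_ideal G R A (left_annihilator_set R X)"
  unfolding graded_left_ideal_def graded_subset_def
proof (intro conjI subset_antisym)
  have "X \<subseteq> carrier R" using X component_closed by blast
  then show left: "left_ideal R (left_annihilator_set R X)"
    by (rule R.left_annihilator_set_left_ideal)
  show "family_sum G R (\<lambda>g. left_annihilator_set R X \<inter> A g) \<subseteq> left_annihilator_set R X"
    using left by (intro family_sum_subset) (auto simp: left_ideal_def)
  show "left_annihilator_set R X \<subseteq> family_sum G R (\<lambda>g. left_annihilator_set R X \<inter> A g)"
  proof
    fix r assume r: "r \<in> left_annihilator_set R X"
    then have "r \<in> family_sum G R A"
      by (simp add: sum_components left_annihilator_set_def)
    then obtain f S where S: "finite S" "S \<subseteq> carrier G" "\<forall>g \<in> S. f g \<in> A g" "r = finsum R f S"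
      unfolding family_sum_def by blast
    have "f g \<otimes>\<^bsub>R\<^esub> x = \<zero>\<^bsub>R\<^esub>" if "x \<in> X" "g \<in> S" for x g
    proof -
      obtain h where "h \<in> carrier G" "x \<in> A h" using X \<open>x \<in> X\<close> by blast
      moreover have "finsum R f S \<otimes>\<^bsub>R\<^esub> x = \<zero>\<^bsub>R\<^esub>"
        using r S(4) \<open>x \<in> X\<close> by (simp add: left_annihilator_set_def)
      ultimately show ?thesis using mult_homogeneous_eq_zero[OF S(1-3)] \<open>g \<in> S\<close> by blast
    qed
    then have "\<forall>g \<in> S. f g \<in> left_annihilator_set R X \<inter> A g"
      using S component_closed by (auto simp: left_annihilator_set_def)
    with S show "r \<in> family_sum G R (\<lambda>g. left_annihilator_set R X \<inter> A g)"
      unfolding family_sum_def by blast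
  qed
qed

lemma set_products_homogeneous:
  assumes "X \<subseteq> (\<Union>h \<in> carrier G. A h)"
  shows "set_products R X n \<subseteq> (\<Union>h \<in> carrier G. A h)"
proof (induction n)
  case (Suc n)
  show ?case
  proof
    fix v assume "v \<in> set_products R X (Suc n)"
    then obtain w x where v: "w \<in> set_products R X n" "x \<in> X" "v = w \<otimes>\<^bsub>R\<^esub> x"
      by (auto simp: set_mult_def)
    then obtain g h where "g \<in> carrier G" "w \<in> A g" "h \<in> carrier G" "x \<in> A h"
      using Suc assms by blast
    with v(3) show "v \<in> (\<Union>h \<in> carrier G. A h)"
      using mult_components by blast
  qed
qed (use assms in simp)

section \<open>Homogeneous singular elements and nilpotency\<close>

definition singular_homogeneous :: "'a set" where
  "singular_homogeneous = (\<Union>g \<in> carrier G. singular_component R A g)"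

lemma singular_homogeneous_subset: "singular_homogeneous \<subseteq> (\<Union>h \<in> carrier G. A h)"
  by (auto simp: singular_homogeneous_def singular_component_def)

lemma singular_homogeneous_closed: "singular_homogeneous \<subseteq> carrier R"
  using singular_homogeneous_subset component_closed by blast

lemma singular_homogeneous_mult:
  "singular_homogeneous <#>\<^bsub>R\<^esub> singular_homogeneous \<subseteq> singular_homogeneous"
proof
  fix v assume "v \<in> singular_homogeneous <#>\<^bsub>R\<^esub> singular_homogeneous"
  then obtain g h x y where "g \<in> carrier G" "x \<in> singular_component R A g"
    "h \<in> carrier G" "y \<in> A h" "v = x \<otimes>\<^bsub>R\<^esub> y"
    unfolding singular_homogeneous_def set_mult_def by (auto simp: singular_component_def)
  then show "v \<in> singular_homogeneous"
    using singular_component_mult(1) unfolding singular_homogeneous_def by blast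
qed

lemma set_products_singular_homogeneous_zero:
  assumes noeth: "graded_left_noetherian G R A"
  obtains n where "set_products R singular_homogeneous n \<subseteq> {\<zero>\<^bsub>R\<^esub>}"
proof -
  let ?H = singular_homogeneous
  let ?W = "set_products R ?H"
  have W: "?W n \<subseteq> carrier R" for n
    by (rule R.set_products_closed[OF singular_homogeneous_closed])
  have "graded_left_ideal G R A (left_annihilator_set R (?W n))" for n
    by (intro left_annihilator_set_graded_left_ideal set_products_homogeneous
        singular_homogeneous_subset)
  moreover have "left_annihilator_set R (?W n) \<subseteq> left_annihilator_set R (?W (Suc n))" for n
    by (intro left_annihilator_set_antimono set_products_Suc_subset singular_homogeneous_mult)
  ultimately have "\<exists>N. \<forall>n \<ge> N. left_annihilator_set R (?W n) = left_annihilator_set R (?W N)"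
    using noeth unfolding graded_left_noetherian_def
    by (elim allE[of _ "\<lambda>n. left_annihilator_set R (?W n)"]) blast
  then obtain N where N: "left_annihilator_set R (?W (Suc N)) = left_annihilator_set R (?W N)"
    by (metis le_SucI order_refl)
  \<comment> \<open>The elements of \<open>?H\<close> that do not kill \<open>?W N\<close>. If there
    are none, \<open>?W (Suc N)\<close>, which is \<open>?H\<close> times \<open>?W N\<close>,
    vanishes.\<close>
  let ?B = "{a \<in> ?H. a \<notin> left_annihilator_set R (?W N)}"
  have "?B = {}"
  proof (rule ccontr)
    assume nonempty: "?B \<noteq> {}"
    have gr: "graded_left_ideal G R A (left_annihilator R a)" if "a \<in> ?H" for a
      using left_annihilator_set_graded_left_ideal[of "{a}"] singular_homogeneous_subset that
      unfolding left_annihilator_set_singleton by blast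
    let ?F = "left_annihilator R ` ?B"
    have F: "graded_left_ideal G R A I" if "I \<in> ?F" for I using gr that by blast
    have F0: "?F \<noteq> {}" using nonempty by blast
    obtain I where "I \<in> ?F" and I: "\<forall>J \<in> ?F. I \<subseteq> J \<longrightarrow> J = I"
      using graded_left_noetherian_maximal[OF noeth F F0] by (rule bexE)
    then obtain a where a: "a \<in> ?B" "I = left_annihilator R a" by auto
    have max: "left_annihilator R c = left_annihilator R a"
      if "c \<in> ?B" "left_annihilator R a \<subseteq> left_annihilator R c" for c
      using bspec[OF I imageI[OF that(1)]] that(2) unfolding a(2) by (rule mp)
    have aH: "a \<in> ?H" and aR: "a \<in> carrier R" using a singular_homogeneous_closed by auto
    \<comment> \<open>Strict growth of the annihilator requires \<open>a\<close> to be
      nonzero.\<close>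
    have a0: "a \<noteq> \<zero>\<^bsub>R\<^esub>"
    proof
      assume "a = \<zero>\<^bsub>R\<^esub>"
      then have "a \<in> left_annihilator_set R (?W N)"
        using W by (auto simp: left_annihilator_set_def subset_iff)
      with a show False by blast
    qed
    have "a \<otimes>\<^bsub>R\<^esub> (b \<otimes>\<^bsub>R\<^esub> w) = \<zero>\<^bsub>R\<^esub>" if b: "b \<in> ?H" and w: "w \<in> ?W N" for b w
    proof -
      have bR: "b \<in> carrier R" using b singular_homogeneous_closed by blast
      have "essential_left_ideal R (left_annihilator R b)"
        using b by (auto simp: singular_homogeneous_def singular_component_def)
      then have "left_annihilator R a \<subset> left_annihilator R (a \<otimes>\<^bsub>R\<^esub> b)"
        by (rule R.left_annihilator_mult_strict[OF aR a0 bR])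
      \<comment> \<open>Maximality is only among members of \<open>?B\<close>, so strict growth
        expels \<open>a b\<close> from \<open>?B\<close>. As \<open>a b\<close> is still in
        \<open>?H\<close>, it must kill \<open>?W N\<close>.\<close>
      then have "a \<otimes>\<^bsub>R\<^esub> b \<notin> ?B" using max by blast
      moreover have "a \<otimes>\<^bsub>R\<^esub> b \<in> ?H"
        using singular_homogeneous_mult aH b unfolding set_mult_def by blast
      ultimately have "(a \<otimes>\<^bsub>R\<^esub> b) \<otimes>\<^bsub>R\<^esub> w = \<zero>\<^bsub>R\<^esub>"
        using w by (simp add: left_annihilator_set_def)
      moreover have "w \<in> carrier R" using w W by blast
      ultimately show ?thesis using aR bR by (simp add: R.m_assoc)
    qed
    then have "a \<in> left_annihilator_set R (?W (Suc N))"
      using aR unfolding R.set_products_Suc_left[OF singular_homogeneous_closed]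
      by (auto simp: left_annihilator_set_def set_mult_def)
    \<comment> \<open>By the choice of \<open>N\<close>, killing \<open>?W (Suc N)\<close> means
      killing \<open>?W N\<close>, which \<open>a \<in> ?B\<close> excludes.\<close>
    with N a show False by blast
  qed
  then have "?W (Suc N) \<subseteq> {\<zero>\<^bsub>R\<^esub>}"
    unfolding R.set_products_Suc_left[OF singular_homogeneous_closed]
    by (auto simp: left_annihilator_set_def set_mult_def)
  then show ?thesis by (rule that)
qed

text \<open>The homogeneous singular elements span the radical additively, so the vanishing of their
  products of \<open>n + 1\<close> factors passes to the power \<open>Suc n\<close> of the
  radical.\<close>

lemma graded_singular_radical_nilpotent:
  assumes "graded_left_noetherian G R A"
  shows "nilpotent_ideal R (graded_singular_radical G R A)"
proof -
  let ?Z = "graded_singular_radical G R A"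
  obtain n where n: "set_products R singular_homogeneous n \<subseteq> {\<zero>\<^bsub>R\<^esub>}"
    using set_products_singular_homogeneous_zero[OF assms] .
  have "?Z [^]\<^bsub>ideals_set R\<^esub> Suc n \<subseteq> {\<zero>\<^bsub>R\<^esub>}"
  proof (rule R.ideals_set_pow_subset[OF graded_singular_radical_ideal
        singular_homogeneous_closed _ _ n])
    show "?Z \<subseteq> K" if "additive_subgroup K R" "singular_homogeneous \<subseteq> K" for K
      unfolding graded_singular_radical_def
      using that by (intro family_sum_subset) (auto simp: singular_homogeneous_def)
    show "additive_subgroup {\<zero>\<^bsub>R\<^esub>} R"
      using R.zeroideal by (rule ideal.axioms(1))
  qed
  \<comment> \<open>Nilpotency demands equality with the zero ideal, so the power must also be seen
    to contain zero.\<close>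
  moreover have "\<zero>\<^bsub>R\<^esub> \<in> ?Z [^]\<^bsub>ideals_set R\<^esub> Suc n"
    using R.ideals_set_pow_ideal[OF graded_singular_radical_ideal]
    by (intro additive_subgroup.zero_closed ideal.axioms(1))
  ultimately show ?thesis
    unfolding nilpotent_ideal_def by (intro exI[of _ "Suc n"]) auto
qed

end

theorem proposition3p2:
  fixes G :: "('g, 'm) monoid_scheme"
    and R :: "('a, 'n) ring_scheme"
    and A :: "'g \<Rightarrow> 'a set"
  assumes "graded_ring G R A"
    and "graded_left_noetherian G R A"
  shows "nilpotent_ideal R (graded_singular_radical G R A)"
  using assms by (rule graded_ring.graded_singular_radical_nilpotent)

end
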